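(* Consider a linear network with $J\ge 1$ nodes. If the functions $\beta_k$, $0\le k\le J$, are continuous and non-decreasing, then there exists a unique solution $u=(u_1,\dots,u_J)\in\mathbb{R}_+^J$ of the fixed point equation $$u_j=\phi_0(u)+\phi_j(u_j),\qquad 1\le j\le J.$$
   Context: $\mathbb{R}_+=[0,\infty)$. The linear network has $J$ nodes and $J+1$ classes of connections: class $j$, $1\le j\le J$, uses node $j$ only, and class $0$ uses all $J$ nodes; the allocation coefficient is $1$ if a class uses a node and $0$ otherwise. For each class $k\in\{0,1,\dots,J\}$, $p_k$ is the proportion of class $k$ connections ($\sum_k p_k=1$), $a_k$ is a non-negative number (linear increase rate), $r_k\in(0,1)$ is the multiplicative decrease factor, and $\beta_k$ is a function with values in $\mathbb{R}_+$ (loss rate function), with $\beta_0$ defined on $\mathbb{R}_+^J$ and $\beta_j$ defined on $\mathbb{R}_+$ for $1\le j\le J$. The functions $\phi_k$ are $$\phi_k(\cdot)=p_k\sqrt{\frac{2}{\pi}}\left(\prod_{n=1}^{\infty}\frac{1-r_k^{2n}}{1-r_k^{2n-1}}\right)\sqrt{\frac{a_k}{\beta_k(\cdot)}}.$$ "Non-decreasing" means non-decreasing with respect to the coordinatewise partial order.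
   Formalization: Each φ_k takes values in [0,∞] (a/0=∞ for a>0, 0/0=0, 0·∞=0) and is assumed finite at some point, i.e. β_k is not identically 0 unless a_k=0 or p_k=0; if β_k≡0 with a_k,p_k>0, no solution exists. *)

theory Defs
  imports "HOL-Analysis.Analysis"
begin

text \<open>
  Connection classes of the linear network whose nodes are the elements of the finite type
  \<open>'n\<close>: the class \<open>None\<close> (class 0) uses all the nodes, the class \<open>Some j\<close> uses node \<open>j\<close> only.
\<close>

type_synonym 'n conn_class = "'n option"

definition esqrt :: "ennreal \<Rightarrow> ennreal" where
  "esqrt x = (if x = \<infinity> then \<infinity> else ennreal (sqrt (enn2real x)))"

text \<open>The index of the product is shifted by one: the factor \<open>n\<close> below is the factor \<open>n + 1\<close> of
  \<open>\<Prod>\<^sub>n\<^sub>\<ge>\<^sub>1 (1 - r\<^sup>2\<^sup>n) / (1 - r\<^sup>2\<^sup>n\<^sup>-\<^sup>1)\<close>.\<close>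

definition aimd_const :: "real \<Rightarrow> real" where
  "aimd_const r = (\<Prod>n. (1 - r ^ (2 * Suc n)) / (1 - r ^ (2 * Suc n - 1)))"

text \<open>
  The value of \<open>\<phi>\<close> for a class with parameters \<open>p\<close>, \<open>a\<close>, \<open>r\<close> at a point where its loss rate
  is \<open>b\<close>. A loss rate may vanish, so the value is taken in \<open>[0, \<infinity>]\<close>: it is \<open>\<infinity>\<close> if
  \<open>b = 0\<close> and \<open>p\<close>, \<open>a\<close> are positive, whereas real division would give \<open>0\<close> there. By the
  conventions \<open>0 / 0 = 0\<close> and \<open>0 * \<infinity> = 0\<close> of \<^typ>\<open>ennreal\<close>, it is \<open>0\<close> if \<open>a = 0\<close> or \<open>p = 0\<close>.
\<close>

definition phi :: "real \<Rightarrow> real \<Rightarrow> real \<Rightarrow> real \<Rightarrow> ennreal" where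
  "phi p a r b =
     ennreal (p * sqrt (2 / pi) * aimd_const r) * esqrt (ennreal a / ennreal b)"

lemma convergent_prod_aimd_const:
  fixes r :: real
  assumes "0 < r" "r < 1"
  shows "convergent_prod (\<lambda>n. (1 - r ^ (2 * Suc n)) / (1 - r ^ (2 * Suc n - 1)))"
proof -
  define f where "f n = (1 - r ^ (2 * Suc n)) / (1 - r ^ (2 * Suc n - 1))" for n
  have bnd: "norm (norm (f n - 1)) \<le> r ^ n" for n
  proof -
    define q where "q = r ^ (2 * n + 1)"
    have q: "0 \<le> q" "q \<le> r"
      using assms power_decreasing[of 1 "2 * n + 1" r] by (simp_all add: q_def)
    have "f n = (1 - r * q) / (1 - q)"
      by (simp add: f_def q_def)
    then have "f n - 1 = q * ((1 - r) / (1 - q))"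
      using q assms by (simp add: field_simps)
    moreover have "0 \<le> (1 - r) / (1 - q)" "(1 - r) / (1 - q) \<le> 1"
      using q assms by simp_all
    ultimately have "norm (f n - 1) \<le> q"
      using q by (metis abs_of_nonneg mult_left_le mult_nonneg_nonneg real_norm_def)
    also have "\<dots> \<le> r ^ n"
      unfolding q_def using assms by (intro power_decreasing) auto
    finally show ?thesis by simp
  qed
  have "summable (\<lambda>n. norm (f n - 1))"
    by (rule summable_comparison_test[OF _ summable_geometric[of r]]) (use bnd assms in auto)
  then have "abs_convergent_prod f"
    by (rule summable_imp_abs_convergent_prod)
  then show ?thesis
    unfolding f_def by (rule abs_convergent_prod_imp_convergent_prod)
qed

lemma phi_eq_real:
  assumes "0 \<le> a" "0 < b"
  shows "phi p a r b = ennreal (p * sqrt (2 / pi) * aimd_const r * sqrt (a / b))"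
  using assms
  by (simp add: phi_def esqrt_def divide_ennreal ennreal_mult'')

end

theory Submission
  imports Defs
begin

text \<open>
  Every \<open>\<phi>\<^sub>k\<close> is continuous and non-increasing with values in \<open>[0, \<infinity>]\<close>, and such a function of one
  variable that is finite somewhere has exactly one fixed point. Hence for each \<open>s \<ge> 0\<close> the
  equation \<open>x = s + \<phi>\<^sub>j(x)\<close> has a unique solution \<open>x\<^sub>j(s)\<close>, which satisfies \<open>x\<^sub>j(s) \<ge> s\<close> and is
  non-decreasing and 1-Lipschitz in \<open>s\<close>. The solutions \<open>u\<close> correspond to the fixed points
  of \<open>s \<mapsto> \<phi>\<^sub>0(x\<^sub>1(s), \<dots>, x\<^sub>J(s))\<close> via \<open>s = \<phi>\<^sub>0(u)\<close>, and this function is again continuous,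
  non-increasing and finite somewhere.
\<close>

text \<open>Connectedness stands in for the intermediate value theorem, as \<open>F\<close> may be
  infinite: the closed sets where the graph lies below and above the diagonal cover the half-line
  and both meet it, so they share a point of it. Two fixed points \<open>y < x\<close> would give
  \<open>F x \<le> F y\<close>, that is \<open>x \<le> y\<close>.\<close>

lemma ex1_fixpoint_antimono_ennreal:
  fixes F :: "real \<Rightarrow> ennreal"
  assumes cont: "continuous_on {0..} F" and anti: "antimono_on {0..} F"
    and v: "0 \<le> v" "F v < \<infinity>"
  shows "\<exists>!x. 0 \<le> x \<and> ennreal x = F x"
proof -
  \<comment> \<open>Extending \<open>F\<close> continuously to the whole line makes \<open>A\<close>
    and \<open>B\<close> closed in the reals.\<close>
  define F' where "F' x = F (max 0 x)" for x
  have cont': "continuous_on UNIV F'"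
    unfolding F'_def by (rule continuous_on_compose2[OF cont]) (auto intro!: continuous_intros)
  define A B where "A = {x. F' x \<le> ennreal x}" and "B = {x. ennreal x \<le> F' x}"
  have closed: "closed A" "closed B"
    unfolding A_def B_def
    by (intro closed_Collect_le cont' continuous_on_ennreal continuous_on_id)+
  \<comment> \<open>Since \<open>F\<close> decreases, any point beyond both \<open>v\<close> and
    \<open>F v\<close> lies in \<open>A\<close>.\<close>
  define w where "w = max v (enn2real (F v))"
  have "F w \<le> F v"
    using monotone_onD[OF anti, of v w] v by (simp add: w_def)
  also have "\<dots> = ennreal (enn2real (F v))"
    using v by simp
  also have "\<dots> \<le> ennreal w"
    by (simp add: w_def ennreal_leI)
  finally have "w \<in> A \<inter> {0..}"
    using v by (simp add: A_def F'_def w_def)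
  moreover have "0 \<in> B \<inter> {0..}"
    by (simp add: B_def)
  moreover have "{0..} \<subseteq> A \<union> B"
    by (auto simp: A_def B_def)
  ultimately have "A \<inter> B \<inter> {0..} \<noteq> {}"
    using closed connected_closed[of "{0::real..}"] by (metis connected_Ici empty_iff)
  then obtain x where "0 \<le> x" "ennreal x = F x"
    by (auto simp: A_def B_def F'_def max_absorb2)
  moreover have "x \<le> y" if "0 \<le> x" "0 \<le> y" "ennreal x = F x" "ennreal y = F y" for x y
  proof (rule ccontr)
    assume "\<not> x \<le> y"
    then have "F x \<le> F y"
      using monotone_onD[OF anti, of y x] that by simp
    then show False
      using \<open>\<not> x \<le> y\<close> that by (metis ennreal_le_iff)
  qed
  ultimately show ?thesis
    by (meson order_antisym)
qed

text \<open>At the solutions \<open>G\<close> is finite, so \<open>x - s = G x\<close> and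
  \<open>x' - s' = G x'\<close> in the reals, and the two values of \<open>G\<close> are ordered
  oppositely to \<open>x\<close> and \<open>x'\<close>.\<close>

lemma shifted_fixpoint_mono_Lipschitz:
  fixes G :: "real \<Rightarrow> ennreal"
  assumes anti: "antimono_on {0..} G"
    and s: "0 \<le> s" "s \<le> s'"
    and x: "0 \<le> x" "ennreal x = ennreal s + G x"
    and x': "0 \<le> x'" "ennreal x' = ennreal s' + G x'"
  shows "x \<le> x'" "x' - x \<le> s' - s"
proof -
  have "G x \<noteq> top" "G x' \<noteq> top"
    using x x' by (metis ennreal_add_eq_top ennreal_neq_top)+
  then obtain g g' where g: "0 \<le> g" "G x = ennreal g" "0 \<le> g'" "G x' = ennreal g'"
    by (metis ennreal_cases)
  have eq: "x = s + g" "x' = s' + g'"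
    using x x' s g by (simp_all flip: ennreal_plus)
  show "x \<le> x'"
  proof (rule ccontr)
    assume "\<not> x \<le> x'"
    then have "g \<le> g'"
      using monotone_onD[OF anti, of x' x] x x' g by simp
    then show False
      using \<open>\<not> x \<le> x'\<close> eq s by simp
  qed
  then have "g' \<le> g"
    using monotone_onD[OF anti, of x x'] x x' g by simp
  then show "x' - x \<le> s' - s"
    using eq by simp
qed

lemma ex1_fixpoint_antimono_vec:
  fixes F :: "real ^ 'n::finite \<Rightarrow> ennreal" and G :: "'n \<Rightarrow> real \<Rightarrow> ennreal"
  assumes F: "continuous_on {0..} F" "antimono_on {0..} F" "\<exists>v\<ge>0. F v < \<infinity>"
    and G: "\<And>j. continuous_on {0..} (G j)" "\<And>j. antimono_on {0..} (G j)"
      "\<And>j. \<exists>x\<ge>0. G j x < \<infinity>"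
  shows "\<exists>!u. 0 \<le> u \<and> (\<forall>j. ennreal (u $ j) = F u + G j (u $ j))"
proof -
  have ex1: "\<exists>!x. 0 \<le> x \<and> ennreal x = ennreal s + G j x" for s j
  proof -
    obtain v where "0 \<le> v" "G j v < \<infinity>"
      using G(3) by blast
    then show ?thesis
      using G(1,2)[of j]
      by (intro ex1_fixpoint_antimono_ennreal[of _ v] continuous_on_add_ennreal continuous_on_const)
        (auto simp: monotone_on_def intro: add_left_mono)
  qed
  \<comment> \<open>For negative \<open>s\<close> the term \<open>ennreal s\<close> is 0, so
    \<open>X\<close> is well defined on the whole line.\<close>
  define X where "X s = (\<chi> j. THE x. 0 \<le> x \<and> ennreal x = ennreal s + G j x)" for s
  have X: "0 \<le> X s $ j \<and> ennreal (X s $ j) = ennreal s + G j (X s $ j)" for s j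
    using theI'[OF ex1[of s j]] by (simp add: X_def)
  have X_unique: "x = X s $ j" if "0 \<le> x" "ennreal x = ennreal s + G j x" for x s j
    using that X ex1 by blast
  have X_nonneg: "0 \<le> X s" for s
    using X by (simp add: less_eq_vec_def)
  have X_mono: "X s $ j \<le> X s' $ j" and X_diff: "X s' $ j - X s $ j \<le> s' - s"
    if "0 \<le> s" "s \<le> s'" for s s' j
    using shifted_fixpoint_mono_Lipschitz[OF G(2) that, of "X s $ j" j "X s' $ j"] X by auto
  have "1-lipschitz_on {0..} (\<lambda>s. X s $ j)" for j
  proof (rule lipschitz_onI)
    show "dist (X s $ j) (X s' $ j) \<le> 1 * dist s s'" if "s \<in> {0..}" "s' \<in> {0..}" for s s'
      using X_mono[of s s' j] X_mono[of s' s j] X_diff[of s s' j] X_diff[of s' s j] that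
      by (cases "s \<le> s'") (auto simp: dist_real_def)
  qed simp
  then have "continuous_on {0..} (\<lambda>s. \<chi> j. X s $ j)"
    by (intro continuous_on_vec_lambda lipschitz_on_continuous_on)
  then have contX: "continuous_on {0..} X"
    by simp
  have cont: "continuous_on {0..} (\<lambda>s. F (X s))"
    using X_nonneg by (intro continuous_on_compose2[OF F(1) contX]) auto
  have anti: "antimono_on {0..} (\<lambda>s. F (X s))"
    using X_nonneg X_mono
    by (intro monotone_onI monotone_onD[OF F(2)]) (auto simp: less_eq_vec_def)
  obtain v where v: "0 \<le> v" "F v < \<infinity>"
    using F(3) by blast
  \<comment> \<open>The sum bounds every coordinate of \<open>v\<close>. As
    \<open>X t $ j \<ge> t\<close>, the vector \<open>X t\<close> dominates \<open>v\<close>, so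
    \<open>F\<close> is finite there too.\<close>
  define t where "t = (\<Sum>j\<in>UNIV. v $ j)"
  have v_nonneg: "0 \<le> v $ j" for j
    using v(1) by (simp add: less_eq_vec_def)
  have t: "0 \<le> t"
    unfolding t_def by (intro sum_nonneg v_nonneg)
  have "v $ j \<le> X t $ j" for j
  proof -
    have "v $ j \<le> t"
      unfolding t_def by (rule member_le_sum) (auto simp: v_nonneg)
    also have "t \<le> X t $ j"
    proof -
      have "ennreal t \<le> ennreal t + G j (X t $ j)"
        by simp
      then show ?thesis
        using X[of t j] by (metis ennreal_le_iff)
    qed
    finally show ?thesis .
  qed
  then have "F (X t) \<le> F v"
    using X_nonneg v by (intro monotone_onD[OF F(2)]) (auto simp: less_eq_vec_def)
  then have "F (X t) < \<infinity>"
    using v by (simp add: le_less_trans)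
  then have "\<exists>!s. 0 \<le> s \<and> ennreal s = F (X s)"
    by (intro ex1_fixpoint_antimono_ennreal[OF cont anti t])
  then obtain s where s: "0 \<le> s" "ennreal s = F (X s)"
    and s_unique: "\<And>s'. 0 \<le> s' \<Longrightarrow> ennreal s' = F (X s') \<Longrightarrow> s' = s"
    by blast
  show ?thesis
  proof (rule ex1I[of _ "X s"])
    show "0 \<le> X s \<and> (\<forall>j. ennreal (X s $ j) = F (X s) + G j (X s $ j))"
      using X X_nonneg s by metis
  next
    fix u assume u: "0 \<le> u \<and> (\<forall>j. ennreal (u $ j) = F u + G j (u $ j))"
    \<comment> \<open>A summand of a real number is finite, so \<open>F u\<close> is a real shift
      \<open>s'\<close>; then \<open>u = X s'\<close>, and \<open>s'\<close> is a fixed point of the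
      scalar map.\<close>
    then have "F u \<noteq> top"
      by (metis ennreal_add_eq_top ennreal_neq_top)
    then obtain s' where s': "0 \<le> s'" "F u = ennreal s'"
      by (metis ennreal_cases)
    have "u = X s'"
      using u s' by (auto simp: vec_eq_iff less_eq_vec_def intro!: X_unique)
    then show "u = X s"
      using s_unique[of s'] s' by simp
  qed
qed

text \<open>Writing \<open>\<phi>\<close> as an inverse makes its continuity at \<open>b = 0\<close>, where it is \<open>\<infinity>\<close>, immediate.\<close>

lemma phi_eq_inverse:
  assumes "0 < a" "0 < p * sqrt (2 / pi) * aimd_const r" "0 \<le> b"
  shows "phi p a r b = inverse (ennreal (sqrt (b / a) / (p * sqrt (2 / pi) * aimd_const r)))"
proof (cases "b = 0")
  case True
  then show ?thesis
    using assms by (auto simp: phi_def esqrt_def ennreal_mult_top)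
next
  case False
  define c where "c = p * sqrt (2 / pi) * aimd_const r"
  have "0 < c"
    using assms(2) by (simp only: c_def)
  then have "0 < sqrt (b / a) / c" "c * sqrt (a / b) = inverse (sqrt (b / a) / c)"
    using assms(1,3) False by (simp_all add: real_sqrt_divide)
  then show ?thesis
    using assms False by (simp add: phi_eq_real inverse_ennreal flip: c_def)
qed

text \<open>\<open>ennreal\<close> truncates negative reals to 0. Together with
  \<open>phi_eq_inverse\<close> this covers both signs of the coefficient, so the sign of the
  infinite product never has to be determined.\<close>

lemma phi_eq_0:
  assumes "a = 0 \<or> p * sqrt (2 / pi) * aimd_const r \<le> 0"
  shows "phi p a r b = 0"
  using assms by (auto simp: phi_def esqrt_def ennreal_neg)

lemma continuous_on_phi:
  assumes "0 \<le> a"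
  shows "continuous_on {0..} (phi p a r)"
proof (cases "a = 0 \<or> p * sqrt (2 / pi) * aimd_const r \<le> 0")
  case True
  then show ?thesis
    by (simp add: phi_eq_0 cong: continuous_on_cong)
next
  case False
  have "continuous_on {0..}
      (\<lambda>b. inverse (ennreal (sqrt (b / a) / (p * sqrt (2 / pi) * aimd_const r))))"
    using False by (intro continuous_on_inverse_ennreal continuous_on_ennreal continuous_intros) auto
  then show ?thesis
    using False assms by (subst continuous_on_cong[OF refl phi_eq_inverse]) auto
qed

lemma antimono_on_phi:
  assumes "0 \<le> a"
  shows "antimono_on {0..} (phi p a r)"
proof (cases "a = 0 \<or> p * sqrt (2 / pi) * aimd_const r \<le> 0")
  case True
  then show ?thesis
    by (simp add: phi_eq_0 monotone_on_def)
next
  case False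
  have inverse_anti: "inverse y \<le> inverse x" if "x \<le> y" for x y :: ennreal
    using that by (simp add: less_eq_ennreal.rep_eq inverse_ennreal.rep_eq ereal_inverse_antimono)
  show ?thesis
    using False assms
    by (intro monotone_onI)
      (auto simp: phi_eq_inverse intro!: inverse_anti ennreal_leI divide_right_mono)
qed

lemma phi_comp:
  fixes b :: "'a::{topological_space, order} \<Rightarrow> real"
  assumes "0 \<le> a" and "\<And>x. x \<in> S \<Longrightarrow> 0 \<le> b x"
    and "continuous_on S b" and "mono_on S b"
  shows "continuous_on S (\<lambda>x. phi p a r (b x))" and "antimono_on S (\<lambda>x. phi p a r (b x))"
proof -
  show "continuous_on S (\<lambda>x. phi p a r (b x))"
    using assms by (intro continuous_on_compose2[OF continuous_on_phi]) auto
  show "antimono_on S (\<lambda>x. phi p a r (b x))"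
    using assms
    by (intro monotone_onI monotone_onD[OF antimono_on_phi]) (auto simp: monotone_on_def)
qed

text \<open>The two finiteness assumptions exclude a loss rate that vanishes identically while its
  class has positive coefficients; the right-hand side would then be infinite everywhere for some
  \<open>j\<close>, and no real \<open>u\<close> could solve the system.\<close>

theorem proposition4:
  fixes p a r :: "'n::finite conn_class \<Rightarrow> real"
    and \<beta>\<^sub>0 :: "real ^ 'n \<Rightarrow> real"
    and \<beta> :: "'n \<Rightarrow> real \<Rightarrow> real"
  assumes "\<And>k. 0 \<le> p k" and "(\<Sum>k\<in>UNIV. p k) = 1"
    and "\<And>k. 0 \<le> a k"
    and "\<And>k. 0 < r k" and "\<And>k. r k < 1"
    and "\<And>u. 0 \<le> u \<Longrightarrow> 0 \<le> \<beta>\<^sub>0 u"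
    and "\<And>j x. 0 \<le> x \<Longrightarrow> 0 \<le> \<beta> j x"
    and "continuous_on {0..} \<beta>\<^sub>0" and "mono_on {0..} \<beta>\<^sub>0"
    and "\<And>j. continuous_on {0..} (\<beta> j)" and "\<And>j. mono_on {0..} (\<beta> j)"
    and "\<exists>v\<ge>0. phi (p None) (a None) (r None) (\<beta>\<^sub>0 v) < \<infinity>"
    and "\<And>j. \<exists>x\<ge>0. phi (p (Some j)) (a (Some j)) (r (Some j)) (\<beta> j x) < \<infinity>"
  shows "\<exists>!u :: real ^ 'n. 0 \<le> u \<and>
    (\<forall>j. ennreal (u $ j) =
      phi (p None) (a None) (r None) (\<beta>\<^sub>0 u) +
      phi (p (Some j)) (a (Some j)) (r (Some j)) (\<beta> j (u $ j)))"
  using assms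
  by (intro ex1_fixpoint_antimono_vec phi_comp) auto

end
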